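(* Consider the stochastic linear regression model $X_k=\theta\phi_k+\varepsilon_k$, $k\in[1,n]$, with unknown parameter $\theta\in\mathbf{R}$ and least-squares estimator $$\theta_n=\frac{\sum_{k=1}^n\phi_kX_k}{\sum_{k=1}^n\phi_k^2}.$$ Assume that $|\phi_k|/\sqrt{\sum_{j=1}^n\phi_j^2}\le\epsilon_1$ for all $k\in[1,n]$ and $$|\mathbf{E}\varepsilon_i^k|\le\frac12\,k!\,\epsilon_2^{k-2}\,\mathbf{E}\varepsilon_i^2\quad\text{for all integers } k\ge2\ \text{and all } i\in[1,n],$$ for two positive numbers $\epsilon_1$ and $\epsilon_2$. Let $\epsilon=\epsilon_1\epsilon_2/\sigma$. Then, for all $x\ge0$ and for each choice of sign $\pm$, $$\mathbf{P}\left(\pm(\theta_n-\theta)\sqrt{\sum_{k=1}^n\phi_k^2}\ge x\sigma\right)\le B_{1,n}(x,\epsilon,1)\le\exp\left\{-\frac{x^2}{2(1+x\epsilon)}\right\}.$$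
   Context: In the model, $X_k$, $\phi_k$, $\varepsilon_k$ are the (real-valued) observations, regression variables and driven noises. The sequence $(\phi_k)$ consists of independent random variables; $(\varepsilon_k)$ is a sequence of i.i.d. random variables with mean zero and variance $\sigma^2>0$ (with $\sigma>0$); and the sequences $(\phi_k)$ and $(\varepsilon_k)$ are independent of each other. It is understood that $\sum_{k=1}^n\phi_k^2>0$ a.s., so that $\theta_n$ is defined. For $x\ge0$ and $\epsilon,v>0$, $$B_{1,n}(x,\epsilon,v)=\exp\left\{-\overline{\lambda}x+n\log\left(1+\frac{\overline{\lambda}^2v^2}{2n(1-\overline{\lambda}\epsilon)}\right)\right\},\qquad\overline{\lambda}=\frac{2x/v^2}{2x\epsilon/v^2+1+\sqrt{1+2x\epsilon/v^2}}.$$ *)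

theory Defs
  imports "HOL-Probability.Probability"
begin

text \<open>
  Least-squares estimator based on the design \<open>\<phi> 1, \<dots>, \<phi> n\<close> and the observations
  \<open>X 1, \<dots>, X n\<close>.  It takes the junk value \<open>0\<close> where the denominator vanishes.
\<close>

definition least_squares ::
  "nat \<Rightarrow> (nat \<Rightarrow> 'a \<Rightarrow> real) \<Rightarrow> (nat \<Rightarrow> 'a \<Rightarrow> real) \<Rightarrow> 'a \<Rightarrow> real" where
  "least_squares n \<phi> X \<omega> = (\<Sum>k=1..n. \<phi> k \<omega> * X k \<omega>) / (\<Sum>k=1..n. (\<phi> k \<omega>)\<^sup>2)"

definition lambda_bar :: "real \<Rightarrow> real \<Rightarrow> real \<Rightarrow> real" where
  "lambda_bar x \<epsilon> v =
     (2 * x / v\<^sup>2) / (2 * x * \<epsilon> / v\<^sup>2 + 1 + sqrt (1 + 2 * x * \<epsilon> / v\<^sup>2))"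

definition B1 :: "nat \<Rightarrow> real \<Rightarrow> real \<Rightarrow> real \<Rightarrow> real" where
  "B1 n x \<epsilon> v =
     exp (- lambda_bar x \<epsilon> v * x
          + real n * ln (1 + (lambda_bar x \<epsilon> v)\<^sup>2 * v\<^sup>2
                             / (2 * real n * (1 - lambda_bar x \<epsilon> v * \<epsilon>))))"

end

theory Submission
  imports Defs
begin

text \<open>
  Writing \<open>a\<^sub>k = \<phi>\<^sub>k / sqrt (\<Sum>\<phi>\<^sub>j\<^sup>2)\<close>, the normalised error is the self-normalised sum
  \<open>\<Sum>a\<^sub>k \<epsilon>\<^sub>k\<close>, whose weights satisfy \<open>\<Sum>a\<^sub>k\<^sup>2 = 1\<close> and are independent of the noise. With the
  weights frozen, expanding the exponential under Bernstein's condition gives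
  \<open>E exp (\<lambda> a\<^sub>k \<epsilon>\<^sub>k / \<sigma>) \<le> 1 + \<lambda>\<^sup>2 a\<^sub>k\<^sup>2 / (2 (1 - \<lambda> \<epsilon>))\<close>, and AM-GM bounds the product of these factors
  by an expression free of the weights. Integrating over the design and applying Markov's
  inequality at \<open>\<lambda> = lambda_bar x \<epsilon> 1\<close> gives the first bound; \<open>ln (1 + y) \<le> y\<close> gives the second.
\<close>

section \<open>Exponential moments under Bernstein's condition\<close>

text \<open>AM-GM without roots: with \<open>m\<close> the mean, apply
  \<open>u \<le> exp (u - 1)\<close> to each \<open>u = a i / m\<close>. The exponents sum to 0, so
  only \<open>m ^ card I\<close> survives.\<close>

lemma prod_le_power_arith_mean:
  fixes a :: "'i \<Rightarrow> real"
  assumes fin: "finite I" and ne: "I \<noteq> {}" and nonneg: "\<And>i. i \<in> I \<Longrightarrow> a i \<ge> 0"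
  shows "(\<Prod>i\<in>I. a i) \<le> ((\<Sum>i\<in>I. a i) / card I) ^ card I"
proof -
  define m where "m = (\<Sum>i\<in>I. a i) / card I"
  have card: "card I > 0" using fin ne by (simp add: card_gt_0_iff)
  show ?thesis
  proof (cases "(\<Sum>i\<in>I. a i) = 0")
    case True
    then have "\<forall>i\<in>I. a i = 0" using fin nonneg by (simp add: sum_nonneg_eq_0_iff)
    then show ?thesis using True card ne fin by auto
  next
    case False
    then have "(\<Sum>i\<in>I. a i) > 0" using sum_nonneg[of I a] nonneg by fastforce
    then have m: "m > 0" using card by (simp add: m_def)
    have "(\<Prod>i\<in>I. a i) \<le> (\<Prod>i\<in>I. m * exp (a i / m - 1))"
    proof (rule prod_mono, intro conjI)
      fix i assume "i \<in> I"
      then show "0 \<le> a i" by (rule nonneg)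
      have "a i / m \<le> exp (a i / m - 1)" using exp_ge_add_one_self[of "a i / m - 1"] by simp
      then show "a i \<le> m * exp (a i / m - 1)" using m by (simp add: field_simps)
    qed
    also have "\<dots> = m ^ card I * exp ((\<Sum>i\<in>I. a i) / m - card I)"
      by (simp add: prod.distrib exp_sum[OF fin, symmetric] sum_subtractf sum_divide_distrib)
    also have "(\<Sum>i\<in>I. a i) / m - card I = 0"
      using False card by (simp add: m_def)
    finally show ?thesis by (simp add: m_def)
  qed
qed

text \<open>The exponential series is integrated term by term: order 0 gives 1, order 1 vanishes by
  centring, and the terms of order at least 2 are dominated by a geometric series of ratio
  \<open>\<bar>t\<bar> * b\<close>, because \<open>fact k\<close> cancels.\<close>

lemma (in prob_space) exponential_moment_bernstein:
  fixes Y :: "'a \<Rightarrow> real"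
    and b t v :: real
  assumes int1: "integrable M Y" and mean: "expectation Y = 0"
    and int: "\<And>k. k \<ge> 2 \<Longrightarrow> integrable M (\<lambda>\<omega>. Y \<omega> ^ k)"
    and moments: "\<And>k. k \<ge> 2 \<Longrightarrow> \<bar>expectation (\<lambda>\<omega>. Y \<omega> ^ k)\<bar> \<le> 1 / 2 * fact k * b ^ (k - 2) * v"
    and b: "b \<ge> 0" and tb: "\<bar>t\<bar> * b < 1"
  shows "integrable M (\<lambda>\<omega>. exp (t * Y \<omega>))"
    and "expectation (\<lambda>\<omega>. exp (t * Y \<omega>)) \<le> 1 + t\<^sup>2 * v / (2 * (1 - \<bar>t\<bar> * b))"
proof -
  have [measurable]: "Y \<in> borel_measurable M" using int1 by simp
  have int_pow: "integrable M (\<lambda>\<omega>. Y \<omega> ^ k)" for k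
  proof -
    consider "k = 0" | "k = 1" | "k \<ge> 2" by linarith
    then show ?thesis using int1 int by cases auto
  qed
  define r where "r = \<bar>t\<bar> * b"
  have r: "0 \<le> r" "r < 1" using b tb by (auto simp: r_def)
  define c where "c k = t ^ k * expectation (\<lambda>\<omega>. Y \<omega> ^ k) / fact k" for k
  have c01: "c 0 = 1" "c (Suc 0) = 0"
    using mean prob_space by (simp_all add: c_def)
  have c_le: "\<bar>c (Suc (Suc k))\<bar> \<le> t\<^sup>2 * v / 2 * r ^ k" for k
  proof -
    have "\<bar>c (Suc (Suc k))\<bar> =
        \<bar>t\<bar> ^ Suc (Suc k) * \<bar>expectation (\<lambda>\<omega>. Y \<omega> ^ Suc (Suc k))\<bar> / fact (Suc (Suc k))"
      by (simp add: c_def abs_mult power_abs del: power_Suc fact_Suc)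
    also have "\<dots> \<le> \<bar>t\<bar> ^ Suc (Suc k) * (1 / 2 * fact (Suc (Suc k)) * b ^ k * v) / fact (Suc (Suc k))"
      using moments[of "Suc (Suc k)"] by (intro divide_right_mono mult_left_mono) auto
    also have "\<dots> = t\<^sup>2 * v / 2 * r ^ k"
    proof -
      have "\<bar>t\<bar> ^ Suc (Suc k) = t\<^sup>2 * \<bar>t\<bar> ^ k"
        by (simp add: power2_eq_square)
      then show ?thesis by (simp del: power_Suc fact_Suc add: r_def power_mult_distrib)
    qed
    finally show ?thesis .
  qed
  \<comment> \<open>The hypothesis bounds no absolute odd moment, so domination must come from the even ones:
    \<open>exp \<bar>u\<bar> \<le> 2 * cosh u\<close>.\<close>
  have int_cosh: "integrable M (\<lambda>\<omega>. cosh (t * Y \<omega>))"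
  proof -
    define f where "f k \<omega> = (if even k then (t * Y \<omega>) ^ k / fact k else 0)" for k :: nat and \<omega>
    have f_sums: "(\<lambda>k. f k \<omega>) sums cosh (t * Y \<omega>)" for \<omega>
      using cosh_converges[of "t * Y \<omega>"] by (simp add: f_def divide_inverse mult.commute cong: if_cong)
    have f_nonneg: "f k \<omega> \<ge> 0" for k \<omega>
      by (auto simp: f_def intro!: divide_nonneg_pos zero_le_even_power)
    have f_int: "integrable M (f k)" for k
      using int_pow[of k] by (cases "even k") (simp_all add: f_def[abs_def] power_mult_distrib)
    have f_exp: "expectation (f k) = (if even k then c k else 0)" for k
      by (cases "even k") (simp_all add: f_def[abs_def] power_mult_distrib c_def)
    \<comment> \<open>The shift by 2 is there because \<open>c_le\<close> covers orders from 2 on;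
      finitely many terms do not affect summability.\<close>
    have "summable (\<lambda>k. expectation (f (k + 2)))"
    proof (rule summable_comparison_test')
      show "summable (\<lambda>k. t\<^sup>2 * v / 2 * r ^ k)"
        using r by (intro summable_mult summable_geometric) simp
      have "t\<^sup>2 * v / 2 * r ^ k \<ge> 0" for k
        using order_trans[OF abs_ge_zero c_le[of k]] .
      then show "norm (expectation (f (k + 2))) \<le> t\<^sup>2 * v / 2 * r ^ k" if "k \<ge> 0" for k
        using c_le[of k] by (simp add: f_exp)
    qed
    then have "summable (\<lambda>k. \<integral>\<omega>. norm (f k \<omega>) \<partial>M)"
      using f_nonneg summable_iff_shift[of "\<lambda>k. expectation (f k)" 2] by simp
    then have "integrable M (\<lambda>\<omega>. \<Sum>k. f k \<omega>)"
      using f_sums f_nonneg by (intro integrable_suminf[OF f_int]) (auto simp: sums_iff)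
    then show ?thesis using f_sums by (simp add: sums_iff)
  qed
  have int_exp_abs: "integrable M (\<lambda>\<omega>. exp \<bar>t * Y \<omega>\<bar>)"
  proof (rule Bochner_Integration.integrable_bound)
    show "integrable M (\<lambda>\<omega>. 2 * cosh (t * Y \<omega>))" using int_cosh by simp
    have "exp \<bar>u\<bar> \<le> 2 * cosh u" for u :: real
      by (cases "u \<ge> 0") (simp_all add: cosh_def)
    then show "AE \<omega> in M. norm (exp \<bar>t * Y \<omega>\<bar>) \<le> norm (2 * cosh (t * Y \<omega>))"
      by (auto intro: order_trans[OF _ abs_ge_self])
  qed simp
  \<comment> \<open>All partial sums lie below the integrable
    \<open>exp \<bar>t * Y \<omega>\<bar>\<close>, so dominated convergence yields both the
    integrability and the exchange of limit and expectation.\<close>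
  define s where "s N \<omega> = (\<Sum>k<N. (t * Y \<omega>) ^ k / fact k)" for N :: nat and \<omega>
  have s_lim: "(\<lambda>N. s N \<omega>) \<longlonglongrightarrow> exp (t * Y \<omega>)" for \<omega>
    using exp_converges[of "t * Y \<omega>"]
    by (simp add: s_def sums_def divide_inverse mult.commute)
  have s_le: "norm (s N \<omega>) \<le> exp \<bar>t * Y \<omega>\<bar>" for N \<omega>
  proof -
    have "norm (s N \<omega>) \<le> (\<Sum>k<N. \<bar>t * Y \<omega>\<bar> ^ k / fact k)"
      unfolding s_def by (rule order_trans[OF norm_sum]) (simp add: power_abs)
    also have "\<dots> \<le> (\<Sum>k. \<bar>t * Y \<omega>\<bar> ^ k / fact k)"
      using exp_converges[of "\<bar>t * Y \<omega>\<bar>"]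
      by (intro sum_le_suminf) (auto simp: sums_iff divide_inverse mult.commute)
    also have "\<dots> = exp \<bar>t * Y \<omega>\<bar>"
      using exp_converges[of "\<bar>t * Y \<omega>\<bar>"] by (simp add: sums_iff divide_inverse mult.commute)
    finally show ?thesis .
  qed
  have [measurable]: "s N \<in> borel_measurable M" for N
    unfolding s_def[abs_def] by measurable
  have AE_lim: "AE \<omega> in M. (\<lambda>N. s N \<omega>) \<longlonglongrightarrow> exp (t * Y \<omega>)" using s_lim by simp
  have AE_le: "AE \<omega> in M. norm (s N \<omega>) \<le> exp \<bar>t * Y \<omega>\<bar>" for N using s_le by simp
  show "integrable M (\<lambda>\<omega>. exp (t * Y \<omega>))"
    by (rule integrable_dominated_convergence[OF _ _ int_exp_abs AE_lim AE_le]) auto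
  have lim: "(\<lambda>N. expectation (s N)) \<longlonglongrightarrow> expectation (\<lambda>\<omega>. exp (t * Y \<omega>))"
    by (rule integral_dominated_convergence[OF _ _ int_exp_abs AE_lim AE_le]) auto
  have s_exp: "expectation (s N) = (\<Sum>k<N. c k)" for N
    unfolding s_def[abs_def] using int_pow
    by (subst Bochner_Integration.integral_sum) (simp_all add: power_mult_distrib c_def)
  have "expectation (s (N + 2)) \<le> 1 + t\<^sup>2 * v / (2 * (1 - r))" for N
  proof -
    \<comment> \<open>The sign comes from the moment bound itself: the right side of
      \<open>c_le\<close> dominates an absolute value.\<close>
    have nonneg: "t\<^sup>2 * v / 2 \<ge> 0" using order_trans[OF abs_ge_zero c_le[of 0]] by simp
    have "expectation (s (N + 2)) = 1 + (\<Sum>k<N. c (Suc (Suc k)))"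
      by (simp add: s_exp sum.lessThan_Suc_shift c01 del: sum.lessThan_Suc)
    also have "(\<Sum>k<N. c (Suc (Suc k))) \<le> (\<Sum>k<N. t\<^sup>2 * v / 2 * r ^ k)"
      using c_le by (intro sum_mono) (meson abs_ge_self order_trans)
    also have "\<dots> = t\<^sup>2 * v / 2 * (\<Sum>k<N. r ^ k)" by (simp add: sum_distrib_left)
    also have "\<dots> \<le> t\<^sup>2 * v / 2 * (1 / (1 - r))"
    proof (rule mult_left_mono[OF _ nonneg])
      have "(\<Sum>k<N. r ^ k) \<le> (\<Sum>k. r ^ k)"
        using r by (intro sum_le_suminf summable_geometric) auto
      then show "(\<Sum>k<N. r ^ k) \<le> 1 / (1 - r)" using r by (simp add: suminf_geometric)
    qed
    finally show ?thesis by simp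
  qed
  then show "expectation (\<lambda>\<omega>. exp (t * Y \<omega>)) \<le> 1 + t\<^sup>2 * v / (2 * (1 - \<bar>t\<bar> * b))"
    unfolding r_def
    by (intro LIMSEQ_le_const2[OF LIMSEQ_ignore_initial_segment[OF lim, of 2]]) auto
qed

text \<open>Independence factorises the integral, and AM-GM makes the bound depend on the weights
  only through the sum of their squares. The \<open>nn_integral\<close> form can later be integrated
  over random weights without integrability conditions.\<close>

lemma (in prob_space) exponential_moment_weighted_sum:
  fixes Y :: "'i \<Rightarrow> 'a \<Rightarrow> real" and c :: "'i \<Rightarrow> real" and b v d :: real
  assumes fin: "finite I" and ne: "I \<noteq> {}"
    and indep: "indep_vars (\<lambda>_. borel) Y I"
    and int1: "\<And>i. i \<in> I \<Longrightarrow> integrable M (Y i)"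
    and mean: "\<And>i. i \<in> I \<Longrightarrow> expectation (Y i) = 0"
    and int: "\<And>i k. i \<in> I \<Longrightarrow> k \<ge> 2 \<Longrightarrow> integrable M (\<lambda>\<omega>. Y i \<omega> ^ k)"
    and moments: "\<And>i k. i \<in> I \<Longrightarrow> k \<ge> 2 \<Longrightarrow>
      \<bar>expectation (\<lambda>\<omega>. Y i \<omega> ^ k)\<bar> \<le> 1 / 2 * fact k * b ^ (k - 2) * v"
    and b: "b \<ge> 0" and v: "v \<ge> 0"
    and c: "\<And>i. i \<in> I \<Longrightarrow> \<bar>c i\<bar> \<le> d" and db: "d * b < 1"
  shows "(\<integral>\<^sup>+\<omega>. exp (\<Sum>i\<in>I. c i * Y i \<omega>) \<partial>M)
    \<le> ennreal ((1 + (\<Sum>i\<in>I. (c i)\<^sup>2) * v / (2 * card I * (1 - d * b))) ^ card I)"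
proof -
  have card: "card I > 0" using fin ne by (simp add: card_gt_0_iff)
  have factor: "(\<integral>\<^sup>+\<omega>. exp (c i * Y i \<omega>) \<partial>M) \<le> ennreal (1 + (c i)\<^sup>2 * v / (2 * (1 - d * b)))"
    if i: "i \<in> I" for i
  proof -
    have cb: "\<bar>c i\<bar> * b \<le> d * b" using c[OF i] b by (rule mult_right_mono)
    note bern = exponential_moment_bernstein[OF int1[OF i] mean[OF i] int[OF i] moments[OF i] b,
        OF _ _ le_less_trans[OF cb db]]
    have "(\<integral>\<^sup>+\<omega>. exp (c i * Y i \<omega>) \<partial>M) = ennreal (expectation (\<lambda>\<omega>. exp (c i * Y i \<omega>)))"
      by (intro nn_integral_eq_integral bern) auto
    also have "\<dots> \<le> ennreal (1 + (c i)\<^sup>2 * v / (2 * (1 - \<bar>c i\<bar> * b)))"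
      by (intro ennreal_leI bern)
    \<comment> \<open>The uniform bound \<open>d\<close> gives all factors the same denominator, so
      that their arithmetic mean is linear in the squares of the weights.\<close>
    also have "\<dots> \<le> ennreal (1 + (c i)\<^sup>2 * v / (2 * (1 - d * b)))"
      using cb db v by (intro ennreal_leI add_left_mono divide_left_mono) auto
    finally show ?thesis .
  qed
  have "(\<integral>\<^sup>+\<omega>. exp (\<Sum>i\<in>I. c i * Y i \<omega>) \<partial>M)
      = (\<integral>\<^sup>+\<omega>. (\<Prod>i\<in>I. ennreal (exp (c i * Y i \<omega>))) \<partial>M)"
    by (simp add: exp_sum fin prod_ennreal)
  also have "\<dots> = (\<Prod>i\<in>I. \<integral>\<^sup>+\<omega>. exp (c i * Y i \<omega>) \<partial>M)"
    by (intro indep_vars_nn_integral fin indep_vars_compose2[OF indep]) auto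
  also have "\<dots> \<le> (\<Prod>i\<in>I. ennreal (1 + (c i)\<^sup>2 * v / (2 * (1 - d * b))))"
    by (intro prod_mono_ennreal factor)
  also have "\<dots> = ennreal (\<Prod>i\<in>I. 1 + (c i)\<^sup>2 * v / (2 * (1 - d * b)))"
    using v db by (intro prod_ennreal) simp
  also have "\<dots> \<le> ennreal (((\<Sum>i\<in>I. 1 + (c i)\<^sup>2 * v / (2 * (1 - d * b))) / card I) ^ card I)"
    using v db by (intro ennreal_leI prod_le_power_arith_mean fin ne) simp
  also have "(\<Sum>i\<in>I. 1 + (c i)\<^sup>2 * v / (2 * (1 - d * b))) / card I
      = 1 + (\<Sum>i\<in>I. (c i)\<^sup>2) * v / (2 * card I * (1 - d * b))"
  proof -
    have "(\<Sum>i\<in>I. 1 + (c i)\<^sup>2 * v / (2 * (1 - d * b)))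
        = card I + (\<Sum>i\<in>I. (c i)\<^sup>2) * v / (2 * (1 - d * b))"
      by (simp add: sum.distrib sum_divide_distrib sum_distrib_right)
    then show ?thesis using card by (simp add: add_divide_distrib mult_ac)
  qed
  finally show ?thesis .
qed

section \<open>Freezing an independent component, and Markov's inequality\<close>

text \<open>Replaces conditioning on \<open>X\<close>: under independence the joint law is a product
  measure, so Tonelli allows \<open>X\<close> to be frozen while \<open>Y\<close> is integrated
  out.\<close>

lemma (in prob_space) nn_integral_indep_var_le:
  assumes indep: "indep_var S X T Y"
    and f [measurable]: "f \<in> borel_measurable (S \<Otimes>\<^sub>M T)"
    and bound: "AE \<omega> in M. (\<integral>\<^sup>+\<eta>. f (X \<omega>, Y \<eta>) \<partial>M) \<le> C"
  shows "(\<integral>\<^sup>+\<omega>. f (X \<omega>, Y \<omega>) \<partial>M) \<le> C"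
proof -
  have X [measurable]: "X \<in> measurable M S" and Y [measurable]: "Y \<in> measurable M T"
    and joint: "distr M S X \<Otimes>\<^sub>M distr M T Y = distr M (S \<Otimes>\<^sub>M T) (\<lambda>\<omega>. (X \<omega>, Y \<omega>))"
    using indep by (auto simp: indep_var_distribution_eq)
  interpret Y: prob_space "distr M T Y" using Y by (rule prob_space_distr)
  have "(\<integral>\<^sup>+\<omega>. f (X \<omega>, Y \<omega>) \<partial>M) = integral\<^sup>N (distr M S X \<Otimes>\<^sub>M distr M T Y) f"
    unfolding joint by (subst nn_integral_distr) auto
  also have "\<dots> = (\<integral>\<^sup>+x. \<integral>\<^sup>+y. f (x, y) \<partial>distr M T Y \<partial>distr M S X)"
    by (rule Y.nn_integral_fst[symmetric])
      (simp add: measurable_cong_sets[OF sets_pair_measure_cong[OF sets_distr sets_distr] refl])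
  also have "\<dots> = (\<integral>\<^sup>+\<omega>. \<integral>\<^sup>+y. f (X \<omega>, y) \<partial>distr M T Y \<partial>M)"
    by (subst nn_integral_distr) (auto intro!: Y.borel_measurable_nn_integral_fst
      simp: measurable_cong_sets[OF sets_pair_measure_cong[OF refl sets_distr] refl])
  also have "\<dots> = (\<integral>\<^sup>+\<omega>. \<integral>\<^sup>+\<eta>. f (X \<omega>, Y \<eta>) \<partial>M \<partial>M)"
    by (intro nn_integral_cong nn_integral_distr) (auto dest: measurable_space[OF X])
  also have "\<dots> \<le> (\<integral>\<^sup>+\<omega>. C \<partial>M)" using bound by (rule nn_integral_mono_AE)
  also have "\<dots> = C" by (simp add: emeasure_space_1)
  finally show ?thesis .
qed

lemma (in prob_space) prob_ge_le_exponential_moment: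
  fixes Z :: "'a \<Rightarrow> real"
  assumes [measurable]: "Z \<in> borel_measurable M"
    and l: "l \<ge> 0" and C: "C \<ge> 0"
    and moment: "(\<integral>\<^sup>+\<omega>. exp (l * Z \<omega>) \<partial>M) \<le> ennreal C"
  shows "prob {\<omega> \<in> space M. Z \<omega> \<ge> x} \<le> exp (- l * x) * C"
proof -
  have "ennreal (prob {\<omega> \<in> space M. Z \<omega> \<ge> x}) = (\<integral>\<^sup>+\<omega>. indicator {\<omega> \<in> space M. Z \<omega> \<ge> x} \<omega> \<partial>M)"
    by (simp add: emeasure_eq_measure)
  also have "\<dots> \<le> (\<integral>\<^sup>+\<omega>. ennreal (exp (- l * x)) * exp (l * Z \<omega>) \<partial>M)"
    using l by (intro nn_integral_mono)
      (auto simp: indicator_def ennreal_mult[symmetric] exp_add[symmetric] mult_left_mono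
        intro!: ennreal_leI[of 1, simplified])
  also have "\<dots> = ennreal (exp (- l * x)) * (\<integral>\<^sup>+\<omega>. exp (l * Z \<omega>) \<partial>M)"
    by (intro nn_integral_cmult) simp
  also have "\<dots> \<le> ennreal (exp (- l * x)) * ennreal C"
    by (intro mult_left_mono moment) simp
  also have "\<dots> = ennreal (exp (- l * x) * C)" using C by (simp add: ennreal_mult)
  finally show ?thesis using C by simp
qed

section \<open>The exponent \<open>lambda_bar\<close> and the bound \<open>B1\<close>\<close>

text \<open>Since \<open>r * r = 1 + 2 * x * e\<close>, the denominator of \<open>lambda_bar\<close>
  factors as \<open>r * (r + 1)\<close>, and \<open>2 * x * e = (r - 1) * (r + 1)\<close>. The
  identity \<open>1 - t * e = 1 / r\<close> is the stationarity condition for minimising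
  \<open>- t * x + t\<^sup>2 / (2 * (1 - t * e))\<close> over
  \<open>0 \<le> t < 1 / e\<close>.\<close>

lemma lambda_bar_1:
  assumes "x \<ge> 0" "e > 0"
  defines "r \<equiv> sqrt (1 + 2 * x * e)"
  shows lambda_bar_1_eq: "lambda_bar x e 1 = 2 * x / (r * (r + 1))"
    and lambda_bar_1_mult: "1 - lambda_bar x e 1 * e = 1 / r"
    and lambda_bar_1_nonneg: "lambda_bar x e 1 \<ge> 0"
    and lambda_bar_1_mult_less: "lambda_bar x e 1 * e < 1"
proof -
  have r: "r \<ge> 1" and r2: "r * r = 1 + 2 * x * e" using assms by (simp_all add: r_def)
  then have "2 * x * e + 1 + r = r * (r + 1)" by (simp add: algebra_simps)
  then show eq: "lambda_bar x e 1 = 2 * x / (r * (r + 1))"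
    by (simp add: lambda_bar_def r_def)
  show nonneg: "lambda_bar x e 1 \<ge> 0" unfolding eq using r assms by simp
  have "lambda_bar x e 1 * e = (r * r - 1) / (r * (r + 1))"
    unfolding eq r2 by (simp add: mult_ac)
  also have "r * r - 1 = (r - 1) * (r + 1)" by (simp add: algebra_simps)
  finally have "lambda_bar x e 1 * e = (r - 1) / r" using r by simp
  then show mult: "1 - lambda_bar x e 1 * e = 1 / r" using r by (simp add: diff_divide_distrib)
  have "1 / r > 0" using r by simp
  then show "lambda_bar x e 1 * e < 1" using mult by linarith
qed

text \<open>This is the shape in which Markov's inequality and AM-GM deliver the bound; positivity
  of the base lets \<open>exp\<close> cancel \<open>ln\<close>.\<close>

lemma B1_eq_power:
  assumes x: "x \<ge> 0" and e: "e > 0"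
  shows "B1 n x e 1 = exp (- lambda_bar x e 1 * x) *
    (1 + (lambda_bar x e 1)\<^sup>2 / (2 * real n * (1 - lambda_bar x e 1 * e))) ^ n"
proof -
  have "1 + (lambda_bar x e 1)\<^sup>2 / (2 * real n * (1 - lambda_bar x e 1 * e)) > 0"
    using lambda_bar_1_mult_less[OF x e] by (intro add_pos_nonneg) auto
  then show ?thesis unfolding B1_def exp_add exp_of_nat_mult by simp
qed

text \<open>Linearising the logarithm leaves the exponent
  \<open>- 2 * x\<^sup>2 / (r + 1)\<^sup>2\<close>, and
  \<open>(r + 1)\<^sup>2 \<le> 2 * r\<^sup>2 + 2 = 4 * (1 + x * e)\<close>.\<close>

lemma B1_le_exp:
  assumes x: "x \<ge> 0" and e: "e > 0"
  shows "B1 n x e 1 \<le> exp (- x\<^sup>2 / (2 * (1 + x * e)))"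
proof -
  define r where "r = sqrt (1 + 2 * x * e)"
  define l where "l = lambda_bar x e 1"
  have r: "r \<ge> 1" and r2: "r\<^sup>2 = 1 + 2 * x * e" using assms by (simp_all add: r_def)
  note l = lambda_bar_1_eq[OF x e, folded r_def l_def] lambda_bar_1_mult[OF x e, folded r_def l_def]
  have "real n * ln (1 + l\<^sup>2 / (2 * real n * (1 - l * e))) \<le> real n * (l\<^sup>2 / (2 * real n * (1 - l * e)))"
    using r l(2) by (intro mult_left_mono ln_add_one_self_le_self) auto
  \<comment> \<open>Equality holds for \<open>n > 0\<close>; for \<open>n = 0\<close> the left side
    is 0.\<close>
  also have "\<dots> \<le> l\<^sup>2 * r / 2"
    using r unfolding l(2) by (cases "n = 0") simp_all
  finally have "- l * x + real n * ln (1 + l\<^sup>2 / (2 * real n * (1 - l * e))) \<le> - l * x + l\<^sup>2 * r / 2"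
    by simp
  also have "\<dots> = - 2 * x\<^sup>2 / (r + 1)\<^sup>2"
  proof -
    have "- l * x = - 2 * x\<^sup>2 * (r + 1) / (r * (r + 1)\<^sup>2)"
      using r unfolding l(1) by (simp add: divide_simps power2_eq_square)
    moreover have "l\<^sup>2 * r / 2 = 2 * x\<^sup>2 / (r * (r + 1)\<^sup>2)"
      using r unfolding l(1) by (simp add: divide_simps power2_eq_square)
    ultimately have "- l * x + l\<^sup>2 * r / 2 = - 2 * x\<^sup>2 * r / (r * (r + 1)\<^sup>2)"
      by (simp add: add_divide_distrib[symmetric] algebra_simps)
    then show ?thesis using r by simp
  qed
  also have "\<dots> \<le> - x\<^sup>2 / (2 * (1 + x * e))"
  proof -
    have "(r + 1)\<^sup>2 + (r - 1)\<^sup>2 = 2 * r\<^sup>2 + 2" by (simp add: power2_eq_square algebra_simps)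
    then have "(r + 1)\<^sup>2 \<le> 2 * r\<^sup>2 + 2" using zero_le_power2[of "r - 1"] by linarith
    then have "(r + 1)\<^sup>2 \<le> 4 * (1 + x * e)" using r2 by simp
    then have "2 * x\<^sup>2 / (4 * (1 + x * e)) \<le> 2 * x\<^sup>2 / (r + 1)\<^sup>2"
      using r by (intro divide_left_mono mult_pos_pos) (auto simp: x e add_pos_nonneg less_imp_le)
    moreover have "x\<^sup>2 / (2 * (1 + x * e)) = 2 * x\<^sup>2 / (4 * (1 + x * e))"
      using mult_divide_mult_cancel_left[of 2 "x\<^sup>2" "2 * (1 + x * e)"] by (simp only: mult.assoc[symmetric]) simp
    ultimately show ?thesis by simp
  qed
  finally show ?thesis by (simp add: B1_def l_def)
qed

section \<open>Tail bound for the normalised estimation error\<close>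

text \<open>If \<open>\<Sum>\<phi>\<^sub>k\<^sup>2 = 0\<close>, both sides are \<open>0\<close>, the right one as the junk value \<open>0 / 0\<close>.\<close>
lemma least_squares_error:
  assumes "\<And>k. k \<in> {1..n} \<Longrightarrow> X k \<omega> = \<theta> * \<phi> k \<omega> + \<epsilon> k \<omega>"
  shows "(least_squares n \<phi> X \<omega> - \<theta>) * sqrt (\<Sum>k=1..n. (\<phi> k \<omega>)\<^sup>2)
    = (\<Sum>k=1..n. \<phi> k \<omega> * \<epsilon> k \<omega>) / sqrt (\<Sum>k=1..n. (\<phi> k \<omega>)\<^sup>2)"
proof (cases "(\<Sum>k=1..n. (\<phi> k \<omega>)\<^sup>2) = 0")
  case False
  define S where "S = (\<Sum>k=1..n. (\<phi> k \<omega>)\<^sup>2)"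
  have S: "S > 0" using False sum_nonneg[of "{1..n}" "\<lambda>k. (\<phi> k \<omega>)\<^sup>2"]
    unfolding S_def by fastforce
  have "(\<Sum>k=1..n. \<phi> k \<omega> * X k \<omega>) = \<theta> * S + (\<Sum>k=1..n. \<phi> k \<omega> * \<epsilon> k \<omega>)"
    unfolding S_def sum_distrib_left sum.distrib[symmetric]
    by (rule sum.cong) (simp_all add: assms algebra_simps power2_eq_square)
  then have "least_squares n \<phi> X \<omega> - \<theta> = (\<Sum>k=1..n. \<phi> k \<omega> * \<epsilon> k \<omega>) / S"
    using S unfolding least_squares_def S_def[symmetric] by (simp add: add_divide_distrib)
  moreover have "sqrt S / S = 1 / sqrt S"
    using S real_div_sqrt[of S] by (simp add: field_simps)
  ultimately show ?thesis
    unfolding S_def[symmetric] by (metis mult.right_neutral times_divide_eq_left times_divide_eq_right)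
qed simp

theorem theorem3p1:
  fixes M :: "'a measure"
    and n :: nat
    and X \<phi> \<epsilon> :: "nat \<Rightarrow> 'a \<Rightarrow> real"
    and \<theta> \<sigma> \<epsilon>1 \<epsilon>2 x s :: real
  assumes prob: "prob_space M"
    and model: "\<And>k \<omega>. k \<in> {1..n} \<Longrightarrow> \<omega> \<in> space M \<Longrightarrow> X k \<omega> = \<theta> * \<phi> k \<omega> + \<epsilon> k \<omega>"
    and indep_\<phi>: "prob_space.indep_vars M (\<lambda>_. borel) \<phi> {1..n}"
    and indep_\<epsilon>: "prob_space.indep_vars M (\<lambda>_. borel) \<epsilon> {1..n}"
    and ident_\<epsilon>: "\<And>i j. i \<in> {1..n} \<Longrightarrow> j \<in> {1..n} \<Longrightarrow> distr M borel (\<epsilon> i) = distr M borel (\<epsilon> j)"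
    and indep_\<phi>_\<epsilon>: "prob_space.indep_var M
          (PiM {1..n} (\<lambda>_. borel)) (\<lambda>\<omega>. \<lambda>k\<in>{1..n}. \<phi> k \<omega>)
          (PiM {1..n} (\<lambda>_. borel)) (\<lambda>\<omega>. \<lambda>k\<in>{1..n}. \<epsilon> k \<omega>)"
    and integrable_\<epsilon>: "\<And>i. i \<in> {1..n} \<Longrightarrow> integrable M (\<epsilon> i)"
    and mean_\<epsilon>: "\<And>i. i \<in> {1..n} \<Longrightarrow> prob_space.expectation M (\<epsilon> i) = 0"
    and sigma_pos: "\<sigma> > 0"
    and variance_\<epsilon>: "\<And>i. i \<in> {1..n} \<Longrightarrow> prob_space.variance M (\<epsilon> i) = \<sigma>\<^sup>2"
    and nondegenerate: "AE \<omega> in M. (\<Sum>k=1..n. (\<phi> k \<omega>)\<^sup>2) > 0"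
    and \<epsilon>1_pos: "\<epsilon>1 > 0" and \<epsilon>2_pos: "\<epsilon>2 > 0"
    and bound_\<phi>: "\<And>k. k \<in> {1..n} \<Longrightarrow>
          AE \<omega> in M. \<bar>\<phi> k \<omega>\<bar> / sqrt (\<Sum>j=1..n. (\<phi> j \<omega>)\<^sup>2) \<le> \<epsilon>1"
    and moments_exist: "\<And>i k. i \<in> {1..n} \<Longrightarrow> k \<ge> 2 \<Longrightarrow> integrable M (\<lambda>\<omega>. \<epsilon> i \<omega> ^ k)"
    and bernstein: "\<And>i k. i \<in> {1..n} \<Longrightarrow> k \<ge> 2 \<Longrightarrow>
          \<bar>prob_space.expectation M (\<lambda>\<omega>. \<epsilon> i \<omega> ^ k)\<bar>
            \<le> 1 / 2 * fact k * \<epsilon>2 ^ (k - 2) * prob_space.expectation M (\<lambda>\<omega>. (\<epsilon> i \<omega>)\<^sup>2)"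
    and x_nonneg: "x \<ge> 0"
    and sign: "s = 1 \<or> s = -1"
  shows "prob_space.prob M {\<omega> \<in> space M.
            s * (least_squares n \<phi> X \<omega> - \<theta>) * sqrt (\<Sum>k=1..n. (\<phi> k \<omega>)\<^sup>2) \<ge> x * \<sigma>}
           \<le> B1 n x (\<epsilon>1 * \<epsilon>2 / \<sigma>) 1
       \<and> B1 n x (\<epsilon>1 * \<epsilon>2 / \<sigma>) 1 \<le> exp (- x\<^sup>2 / (2 * (1 + x * (\<epsilon>1 * \<epsilon>2 / \<sigma>))))"
proof -
  interpret prob_space M by (rule prob)
  define I where "I = {1..n}"
  define S where "S p = (\<Sum>k\<in>I. (p k)\<^sup>2)" for p :: "nat \<Rightarrow> real"
  define e where "e = \<epsilon>1 * \<epsilon>2 / \<sigma>"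
  define l where "l = lambda_bar x e 1"
  \<comment> \<open>The weights for a frozen design \<open>p\<close> absorb \<open>l\<close>, the
    sign and \<open>1 / \<sigma>\<close>, so both tails are treated at once.\<close>
  define c where "c p k = l * (s * p k / sqrt (S p) / \<sigma>)" for p :: "nat \<Rightarrow> real" and k
  define F where "F = (\<lambda>\<omega>. \<lambda>k\<in>I. \<phi> k \<omega>)"
  define G where "G = (\<lambda>\<omega>. \<lambda>k\<in>I. \<epsilon> k \<omega>)"
  define Z where "Z \<omega> = s * (\<Sum>k\<in>I. \<phi> k \<omega> * \<epsilon> k \<omega>) / sqrt (S (\<lambda>k. \<phi> k \<omega>)) / \<sigma>" for \<omega>
  define C where "C = (1 + l\<^sup>2 / (2 * real n * (1 - l * e))) ^ n"
  have e: "e > 0" using \<epsilon>1_pos \<epsilon>2_pos sigma_pos by (simp add: e_def)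
  have l: "l \<ge> 0" and le: "l * e < 1"
    using lambda_bar_1_nonneg[OF x_nonneg e] lambda_bar_1_mult_less[OF x_nonneg e]
    by (simp_all add: l_def)
  have "n \<noteq> 0"
  proof
    assume "n = 0"
    then have "AE \<omega> in M. False" using nondegenerate by simp
    then show False by simp
  qed
  then have I: "finite I" "I \<noteq> {}" "card I = n" by (auto simp: I_def)
  have rv [measurable]: "\<phi> k \<in> borel_measurable M" "\<epsilon> k \<in> borel_measurable M" if "k \<in> I" for k
    using indep_\<phi> indep_\<epsilon> that by (auto simp: indep_vars_def I_def)
  have [measurable]: "Z \<in> borel_measurable M"
    unfolding Z_def[abs_def] S_def by measurable
  have second: "expectation (\<lambda>\<omega>. (\<epsilon> i \<omega>)\<^sup>2) = \<sigma>\<^sup>2" if "i \<in> I" for i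
    using variance_\<epsilon>[of i] mean_\<epsilon>[of i] that by (simp add: I_def)
  have frozen: "(\<integral>\<^sup>+\<eta>. exp (\<Sum>k\<in>I. c p k * \<epsilon> k \<eta>) \<partial>M) \<le> ennreal C"
    if S: "S p > 0" and p: "\<And>k. k \<in> I \<Longrightarrow> \<bar>p k\<bar> / sqrt (S p) \<le> \<epsilon>1" for p
  proof -
    have c_sq: "(\<Sum>k\<in>I. (c p k)\<^sup>2) = l\<^sup>2 / \<sigma>\<^sup>2"
    proof -
      have "(c p k)\<^sup>2 = l\<^sup>2 / \<sigma>\<^sup>2 / S p * (p k)\<^sup>2" for k
        using sign S by (auto simp: c_def power_mult_distrib power_divide)
      then have "(\<Sum>k\<in>I. (c p k)\<^sup>2) = l\<^sup>2 / \<sigma>\<^sup>2 / S p * (\<Sum>k\<in>I. (p k)\<^sup>2)"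
        by (simp only: sum_distrib_left)
      then show ?thesis using S unfolding S_def[symmetric] by simp
    qed
    \<comment> \<open>Weight bound times Bernstein scale: this product is what dictates the choice
      of \<open>e\<close>.\<close>
    have db: "l * \<epsilon>1 / \<sigma> * \<epsilon>2 = l * e" by (simp add: e_def)
    have c_le: "\<bar>c p k\<bar> \<le> l * \<epsilon>1 / \<sigma>" if "k \<in> I" for k
    proof -
      have "\<bar>c p k\<bar> = l * (\<bar>p k\<bar> / sqrt (S p)) / \<sigma>"
        using sign l sigma_pos S by (auto simp: c_def abs_mult)
      also have "\<dots> \<le> l * \<epsilon>1 / \<sigma>"
        using l sigma_pos by (intro divide_right_mono mult_left_mono p that) auto
      finally show ?thesis .
    qed
    have "(\<integral>\<^sup>+\<eta>. exp (\<Sum>k\<in>I. c p k * \<epsilon> k \<eta>) \<partial>M)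
      \<le> (1 + (\<Sum>k\<in>I. (c p k)\<^sup>2) * \<sigma>\<^sup>2 / (2 * card I * (1 - l * \<epsilon>1 / \<sigma> * \<epsilon>2))) ^ card I"
    proof (rule exponential_moment_weighted_sum[OF I(1,2)])
      show "indep_vars (\<lambda>_. borel) \<epsilon> I" using indep_\<epsilon> by (simp add: I_def)
      show "\<bar>expectation (\<lambda>\<omega>. \<epsilon> i \<omega> ^ k)\<bar> \<le> 1 / 2 * fact k * \<epsilon>2 ^ (k - 2) * \<sigma>\<^sup>2"
        if "i \<in> I" "k \<ge> 2" for i k
        using bernstein[of i k] second[of i] that by (simp add: I_def)
      show "l * \<epsilon>1 / \<sigma> * \<epsilon>2 < 1" using le db by simp
    qed (use integrable_\<epsilon> mean_\<epsilon> moments_exist \<epsilon>2_pos c_le in \<open>auto simp: I_def\<close>)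
    then show ?thesis using sigma_pos unfolding c_sq db I(3) C_def by simp
  qed
  have "(\<integral>\<^sup>+\<omega>. exp (l * Z \<omega>) \<partial>M) = (\<integral>\<^sup>+\<omega>. exp (\<Sum>k\<in>I. c (F \<omega>) k * G \<omega> k) \<partial>M)"
  proof -
    \<comment> \<open>Valid at every \<open>\<omega>\<close>: where \<open>S\<close> vanishes,
      division by zero makes both sides 0.\<close>
    have "l * Z \<omega> = (\<Sum>k\<in>I. c (F \<omega>) k * G \<omega> k)" for \<omega>
      by (simp add: Z_def c_def S_def F_def G_def sum_distrib_left sum_divide_distrib mult_ac)
    then show ?thesis by simp
  qed
  also have "\<dots> \<le> ennreal C"
  proof (rule nn_integral_indep_var_le[where f = "\<lambda>(p, q). ennreal (exp (\<Sum>k\<in>I. c p k * q k))"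
        and X = F and Y = G, simplified])
    show "indep_var (PiM I (\<lambda>_. borel)) F (PiM I (\<lambda>_. borel)) G"
      using indep_\<phi>_\<epsilon> by (simp add: I_def F_def G_def)
    show "(\<lambda>(p, q). ennreal (exp (\<Sum>k\<in>I. c p k * q k)))
        \<in> borel_measurable (PiM I (\<lambda>_. borel) \<Otimes>\<^sub>M PiM I (\<lambda>_. borel))"
      unfolding c_def S_def by measurable
    \<comment> \<open>Finitely many null sets are merged, so that \<open>frozen\<close> applies to
      almost every realisation of the design.\<close>
    have "AE \<omega> in M. \<forall>k\<in>I. \<bar>\<phi> k \<omega>\<bar> / sqrt (S (\<lambda>k. \<phi> k \<omega>)) \<le> \<epsilon>1"
      using bound_\<phi> I(1) by (intro AE_finite_allI) (auto simp: S_def I_def)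
    moreover have "AE \<omega> in M. S (\<lambda>k. \<phi> k \<omega>) > 0"
      using nondegenerate by (simp add: S_def I_def)
    ultimately show "AE \<omega> in M. (\<integral>\<^sup>+\<eta>. ennreal (exp (\<Sum>k\<in>I. c (F \<omega>) k * G \<eta> k)) \<partial>M) \<le> ennreal C"
    proof eventually_elim
      case (elim \<omega>)
      have "S (F \<omega>) = S (\<lambda>k. \<phi> k \<omega>)" by (simp add: S_def F_def)
      then show ?case using elim frozen[of "F \<omega>"] by (simp add: F_def G_def)
    qed
  qed
  finally have moment: "(\<integral>\<^sup>+\<omega>. exp (l * Z \<omega>) \<partial>M) \<le> ennreal C" .
  have "C \<ge> 0" using le by (simp add: C_def)
  then have "prob {\<omega> \<in> space M. Z \<omega> \<ge> x} \<le> exp (- l * x) * C"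
    using l moment by (intro prob_ge_le_exponential_moment) auto
  also have "\<dots> = B1 n x e 1"
    using B1_eq_power[OF x_nonneg e] by (simp add: l_def C_def)
  finally have "prob {\<omega> \<in> space M. Z \<omega> \<ge> x} \<le> B1 n x e 1" .
  \<comment> \<open>The events coincide exactly, not just almost surely, because
    \<open>least_squares_error\<close> also covers a vanishing denominator.\<close>
  moreover have "{\<omega> \<in> space M.
      s * (least_squares n \<phi> X \<omega> - \<theta>) * sqrt (\<Sum>k=1..n. (\<phi> k \<omega>)\<^sup>2) \<ge> x * \<sigma>}
      = {\<omega> \<in> space M. Z \<omega> \<ge> x}"
  proof (rule Collect_cong, rule conj_cong[OF refl])
    fix \<omega> assume "\<omega> \<in> space M"
    then have "(least_squares n \<phi> X \<omega> - \<theta>) * sqrt (\<Sum>k=1..n. (\<phi> k \<omega>)\<^sup>2)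
        = (\<Sum>k=1..n. \<phi> k \<omega> * \<epsilon> k \<omega>) / sqrt (\<Sum>k=1..n. (\<phi> k \<omega>)\<^sup>2)"
      by (intro least_squares_error model)
    then have "s * (least_squares n \<phi> X \<omega> - \<theta>) * sqrt (\<Sum>k=1..n. (\<phi> k \<omega>)\<^sup>2) = Z \<omega> * \<sigma>"
      using sigma_pos by (simp add: Z_def S_def I_def mult.assoc)
    then show "(s * (least_squares n \<phi> X \<omega> - \<theta>) * sqrt (\<Sum>k=1..n. (\<phi> k \<omega>)\<^sup>2) \<ge> x * \<sigma>)
        = (Z \<omega> \<ge> x)"
      using sigma_pos by simp
  qed
  ultimately show ?thesis using B1_le_exp[OF x_nonneg e, of n] by (simp add: e_def)
qed

end
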